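(* In $U_q(\mathfrak{sl}_2)$, the Casimir element $\Lambda$ looks as follows in terms of $A,y^{\pm1}$: $$\Lambda = \frac{A^2y-(q^2+q^{-2})AyA+yA^2+(q^2-q^{-2})^2y+(a+a^{-1})(q-q^{-1})^2 A}{(q-q^{-1})(q^2-q^{-2})}.$$
   Context: $\mathbb{F}$ is a field, $q\in\mathbb{F}$ is nonzero with $q^4\neq 1$, and $a\in\mathbb{F}$ is nonzero with $a^2\neq 1$. $U_q(\mathfrak{sl}_2)$ is the (associative unital) $\mathbb{F}$-algebra with generators $e,f,k^{\pm1}$ and relations $kk^{-1}=k^{-1}k=1$, $kek^{-1}=q^2e$, $kfk^{-1}=q^{-2}f$, $ef-fe=\frac{k-k^{-1}}{q-q^{-1}}$. It also has the equitable presentation with generators $x,y^{\pm1},z$ and relations $yy^{-1}=y^{-1}y=1$, $\frac{qxy-q^{-1}yx}{q-q^{-1}}=\frac{qyz-q^{-1}zy}{q-q^{-1}}=\frac{qzx-q^{-1}xz}{q-q^{-1}}=1$; the two are identified via $x=k^{-1}-k^{-1}eq(q-q^{-1})$, $y^{\pm1}=k^{\pm1}$, $z=k^{-1}+f(q-q^{-1})$. The Casimir element is $\Lambda=(q-q^{-1})^2ef+q^{-1}k+qk^{-1}$. Define $A=a^{-1}x+az$. *)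

theory Defs
  imports
    "HOL-Library.Poly_Mapping"
    "HOL-Algebra.QuotRing"
    "HOL-Algebra.Module"
begin

text \<open>
  The free associative unital algebra on a set of generators \<open>'g\<close> over a field \<open>'f\<close> is the monoid
  algebra of the free monoid on \<open>'g\<close>, i.e. the finitely supported functions from words to
  scalars with the convolution product. \<^typ>\<open>'a \<Rightarrow>\<^sub>0 'b\<close> writes the monoid additively, so
  concatenation of words is called \<open>+\<close> and the empty word \<open>0\<close>.
\<close>

datatype 'g word = Word (letters: "'g list")

instantiation word :: (type) monoid_add
begin
definition zero_word :: "'a word" where "0 = Word []"
definition plus_word :: "'a word \<Rightarrow> 'a word \<Rightarrow> 'a word"
  where "u + v = Word (letters u @ letters v)"
instance by standard (simp_all add: zero_word_def plus_word_def)
end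

type_synonym ('g, 'f) free_alg = "'g word \<Rightarrow>\<^sub>0 'f"

definition gen :: "'g \<Rightarrow> ('g, 'f::field) free_alg"
  where "gen g = Poly_Mapping.single (Word [g]) 1"

definition scal :: "'f \<Rightarrow> ('g, 'f::field) free_alg"
  where "scal c = Poly_Mapping.single 0 c"

definition class_ring :: "'r::ring_1 ring"
  where "class_ring = \<lparr>carrier = UNIV, mult = (*), one = 1, zero = 0, add = (+)\<rparr>"

text \<open>
  The algebra with given relators: the quotient of the free algebra by the two-sided ideal they
  generate. The scalar \<open>c\<close> acts as multiplication by the class of \<open>c\<cdot>1\<close>.
\<close>

definition rel_ideal :: "('g, 'f::field) free_alg set \<Rightarrow> ('g, 'f) free_alg set"
  where "rel_ideal R = Idl\<^bsub>class_ring\<^esub> R"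

definition rel_class :: "('g, 'f::field) free_alg set \<Rightarrow> ('g, 'f) free_alg \<Rightarrow> ('g, 'f) free_alg set"
  where "rel_class R p = rel_ideal R +>\<^bsub>class_ring\<^esub> p"

definition presented_alg ::
    "('g, 'f::field) free_alg set \<Rightarrow> ('f, ('g, 'f) free_alg set) module"
  where "presented_alg R =
    (let Q = class_ring Quot rel_ideal R in
      \<lparr>carrier = carrier Q, mult = mult Q, one = one Q, zero = zero Q, add = add Q,
       smult = (\<lambda>c X. rel_class R (scal c) \<otimes>\<^bsub>Q\<^esub> X)\<rparr>)"

datatype chevalley = E | F | K | K_inv

definition Uq_relators :: "'f::field \<Rightarrow> (chevalley, 'f) free_alg set"
  where "Uq_relators q =
    {gen K * gen K_inv - 1,
     gen K_inv * gen K - 1,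
     gen K * gen E * gen K_inv - scal (q^2) * gen E,
     gen K * gen F * gen K_inv - scal (inverse (q^2)) * gen F,
     gen E * gen F - gen F * gen E
       - scal (inverse (q - inverse q)) * (gen K - gen K_inv)}"

definition Uq :: "'f::field \<Rightarrow> ('f, (chevalley, 'f) free_alg set) module"
  where "Uq q = presented_alg (Uq_relators q)"

definition Uq_e where "Uq_e q = rel_class (Uq_relators q) (gen E)"
definition Uq_f where "Uq_f q = rel_class (Uq_relators q) (gen F)"
definition Uq_k where "Uq_k q = rel_class (Uq_relators q) (gen K)"
definition Uq_k_inv where "Uq_k_inv q = rel_class (Uq_relators q) (gen K_inv)"

text \<open>The equitable generators. The inverse of \<open>y\<close> is \<^term>\<open>Uq_k_inv q\<close>.\<close>

definition Uq_x where
  "Uq_x q = Uq_k_inv q \<ominus>\<^bsub>Uq q\<^esub>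
     (q * (q - inverse q)) \<odot>\<^bsub>Uq q\<^esub> (Uq_k_inv q \<otimes>\<^bsub>Uq q\<^esub> Uq_e q)"

definition Uq_y where "Uq_y q = Uq_k q"

definition Uq_z where
  "Uq_z q = Uq_k_inv q \<oplus>\<^bsub>Uq q\<^esub> (q - inverse q) \<odot>\<^bsub>Uq q\<^esub> Uq_f q"

definition Uq_Casimir where
  "Uq_Casimir q =
     ((q - inverse q)^2) \<odot>\<^bsub>Uq q\<^esub> (Uq_e q \<otimes>\<^bsub>Uq q\<^esub> Uq_f q)
     \<oplus>\<^bsub>Uq q\<^esub> inverse q \<odot>\<^bsub>Uq q\<^esub> Uq_k q
     \<oplus>\<^bsub>Uq q\<^esub> q \<odot>\<^bsub>Uq q\<^esub> Uq_k_inv q"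

definition Uq_A where
  "Uq_A q a = inverse a \<odot>\<^bsub>Uq q\<^esub> Uq_x q \<oplus>\<^bsub>Uq q\<^esub> a \<odot>\<^bsub>Uq q\<^esub> Uq_z q"

lemma class_ring_simps [simp]:
  "carrier class_ring = UNIV" "x \<otimes>\<^bsub>class_ring\<^esub> y = x * y" "\<one>\<^bsub>class_ring\<^esub> = 1"
  "\<zero>\<^bsub>class_ring\<^esub> = 0" "x \<oplus>\<^bsub>class_ring\<^esub> y = x + y"
  by (simp_all add: class_ring_def)

lemma ring_class_ring: "ring (class_ring :: 'r::ring_1 ring)"
proof (rule ringI)
  show "abelian_group (class_ring :: 'r ring)"
    by (rule abelian_groupI) (auto simp: algebra_simps intro: exI[of _ "- _"])
  show "Group.monoid (class_ring :: 'r ring)"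
    by (rule monoidI) (auto simp: algebra_simps)
qed (auto simp: algebra_simps)

lemma cring_class_ring: "cring (class_ring :: 'r::comm_ring_1 ring)"
  by (intro cring.intro ring_class_ring comm_monoid.intro comm_monoid_axioms.intro
        ring.is_monoid[OF ring_class_ring]) (simp add: mult.commute)

lemma ideal_rel_ideal: "ideal (rel_ideal R) class_ring"
  unfolding rel_ideal_def by (rule ring.genideal_ideal[OF ring_class_ring]) simp

lemma presented_alg_simps:
  "carrier (presented_alg R) = range (rel_class R)"
  "\<one>\<^bsub>presented_alg R\<^esub> = rel_class R 1"
  "\<zero>\<^bsub>presented_alg R\<^esub> = rel_class R 0"
  "rel_class R p \<otimes>\<^bsub>presented_alg R\<^esub> rel_class R p' = rel_class R (p * p')"
  "rel_class R p \<oplus>\<^bsub>presented_alg R\<^esub> rel_class R p' = rel_class R (p + p')"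
  "c \<odot>\<^bsub>presented_alg R\<^esub> rel_class R p = rel_class R (scal c * p)"
proof -
  interpret ideal "rel_ideal R" class_ring by (rule ideal_rel_ideal)
  note h = rcos_ring_hom
  show "carrier (presented_alg R) = range (rel_class R)"
    by (auto simp: presented_alg_def Let_def FactRing_def A_RCOSETS_defs rel_class_def
        a_r_coset_def r_coset_def)
  show "\<one>\<^bsub>presented_alg R\<^esub> = rel_class R 1"
    by (simp add: presented_alg_def Let_def FactRing_def rel_class_def)
  show "\<zero>\<^bsub>presented_alg R\<^esub> = rel_class R 0"
    using a_rcos_const[OF additive_subgroup.zero_closed[OF is_additive_subgroup]]
    by (simp add: presented_alg_def Let_def FactRing_def rel_class_def)
  show "rel_class R p \<otimes>\<^bsub>presented_alg R\<^esub> rel_class R p' = rel_class R (p * p')"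
    using ring_hom_mult[OF h, of p p'] by (simp add: presented_alg_def Let_def rel_class_def)
  show "rel_class R p \<oplus>\<^bsub>presented_alg R\<^esub> rel_class R p' = rel_class R (p + p')"
    using ring_hom_add[OF h, of p p'] by (simp add: presented_alg_def Let_def rel_class_def)
  show "c \<odot>\<^bsub>presented_alg R\<^esub> rel_class R p = rel_class R (scal c * p)"
    using ring_hom_mult[OF h, of "scal c" p]
    by (simp add: presented_alg_def Let_def rel_class_def)
qed

lemma rel_class_eq_iff: "rel_class R p = rel_class R p' \<longleftrightarrow> p - p' \<in> rel_ideal R"
proof -
  interpret ideal "rel_ideal R" class_ring by (rule ideal_rel_ideal)
  have neg: "\<ominus>\<^bsub>class_ring\<^esub> p' = - p'"
    by (rule minus_equality) auto
  show ?thesis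
    using quotient_eq_iff_same_a_r_cos[OF ideal_rel_ideal, of p p' R] neg
    by (simp add: rel_class_def a_minus_def)
qed

lemma ring_presented_alg: "ring (presented_alg R)"
proof (rule ringI)
  have "\<exists>p'. rel_class R (p' + p) = rel_class R 0" for p
    by (rule exI[of _ "- p"]) simp
  then show "abelian_group (presented_alg R)"
    by (intro abelian_groupI) (auto simp: presented_alg_simps algebra_simps)
  show "Group.monoid (presented_alg R)"
    by (rule monoidI) (auto simp: presented_alg_simps mult.assoc)
qed (auto simp: presented_alg_simps algebra_simps)

lemma presented_alg_minus:
  "rel_class R p \<ominus>\<^bsub>presented_alg R\<^esub> rel_class R p' = rel_class R (p - p')"
proof -
  interpret ring "presented_alg R" by (rule ring_presented_alg)
  have "\<ominus>\<^bsub>presented_alg R\<^esub> rel_class R p' = rel_class R (- p')"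
    by (rule minus_equality) (simp_all add: presented_alg_simps)
  then show ?thesis by (simp add: a_minus_def presented_alg_simps)
qed

lemma scal_simps:
  "scal (c + d) = scal c + scal d" "scal (c * d) = scal c * scal d" "scal 1 = 1"
  by (simp_all add: scal_def single_add mult_single)

lemma scal_central: "scal c * p = p * scal c"
proof (induction p rule: update_induct)
  case const
  show ?case by simp
next
  case (update p w v)
  have "Poly_Mapping.update w v p = Poly_Mapping.single w v + p"
    using update(1)
    by (intro poly_mapping_eqI)
       (auto simp: lookup_update lookup_add lookup_single when_def in_keys_iff)
  moreover have "scal c * Poly_Mapping.single w v = Poly_Mapping.single w v * scal c"
    by (simp add: scal_def mult_single mult.commute)
  ultimately show ?case
    using update(3) by (simp add: distrib_left distrib_right)
qed

lemma module_presented_alg: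
  "module (class_ring :: 'f::field ring) (presented_alg R :: ('f, ('g, 'f) free_alg set) module)"
  by (rule moduleI[OF cring_class_ring ring.is_abelian_group[OF ring_presented_alg]])
     (auto simp: presented_alg_simps scal_simps algebra_simps)

lemma smult_mult_presented_alg:
  assumes "X \<in> carrier (presented_alg R)" "Y \<in> carrier (presented_alg R)"
  shows "(c \<odot>\<^bsub>presented_alg R\<^esub> X) \<otimes>\<^bsub>presented_alg R\<^esub> Y
           = c \<odot>\<^bsub>presented_alg R\<^esub> (X \<otimes>\<^bsub>presented_alg R\<^esub> Y)"
    and "X \<otimes>\<^bsub>presented_alg R\<^esub> (c \<odot>\<^bsub>presented_alg R\<^esub> Y)
           = c \<odot>\<^bsub>presented_alg R\<^esub> (X \<otimes>\<^bsub>presented_alg R\<^esub> Y)"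
  using assms by (auto simp: presented_alg_simps scal_central mult.assoc)

lemma rel_class_relator: "p - p' \<in> R \<Longrightarrow> rel_class R p = rel_class R p'"
  using ring.genideal_self[OF ring_class_ring, of R] by (auto simp: rel_class_eq_iff rel_ideal_def)

lemma Uq_relations:
  "Uq_k q \<otimes>\<^bsub>Uq q\<^esub> Uq_k_inv q = \<one>\<^bsub>Uq q\<^esub>"
  "Uq_k_inv q \<otimes>\<^bsub>Uq q\<^esub> Uq_k q = \<one>\<^bsub>Uq q\<^esub>"
  "Uq_k q \<otimes>\<^bsub>Uq q\<^esub> Uq_e q \<otimes>\<^bsub>Uq q\<^esub> Uq_k_inv q = q^2 \<odot>\<^bsub>Uq q\<^esub> Uq_e q"
  "Uq_k q \<otimes>\<^bsub>Uq q\<^esub> Uq_f q \<otimes>\<^bsub>Uq q\<^esub> Uq_k_inv q = inverse (q^2) \<odot>\<^bsub>Uq q\<^esub> Uq_f q"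
  "Uq_e q \<otimes>\<^bsub>Uq q\<^esub> Uq_f q \<ominus>\<^bsub>Uq q\<^esub> Uq_f q \<otimes>\<^bsub>Uq q\<^esub> Uq_e q
     = inverse (q - inverse q) \<odot>\<^bsub>Uq q\<^esub> (Uq_k q \<ominus>\<^bsub>Uq q\<^esub> Uq_k_inv q)"
  by (simp_all add: Uq_def Uq_k_def Uq_k_inv_def Uq_e_def Uq_f_def presented_alg_simps
        presented_alg_minus)
     (rule rel_class_relator; simp add: Uq_relators_def)+

end

theory Submission
  imports Defs
begin

text \<open>Write h = q - q^-1, w = q^2 - q^-2, s = a + a^-1. In terms of the Chevalley generators,
  A is a combination of k^-1, k^-1 e and f, so the products Ay and yA lose k^-1: both are
  combinations of 1, e and fk with the same constant term s (\<open>A_y_class\<close>). Hence Ay -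
  q^-2 yA and yA - q^2 Ay contain no e, and A^2 y - (q^2 + q^-2) AyA + yA^2 is A times the former
  plus the latter times A. Adding s h^2 A removes the terms linear in A, and what is left is a h w
  times q^-2 A(fk) - (fk)A (\<open>Askey_Wilson_class\<close>).

  In this twisted commutator the f and ffk terms cancel. The relation between ef and fe turns the
  rest into a^-1 (h^2 ef - q k + q k^-1) (\<open>twisted_commutator_class\<close>). This is already
  a^-1 times the Casimir element except for the coefficient of k. The summand w^2 y corrects it:
  after division by h w it contributes (w/h) k = (q + q^-1) k, and -q + q + q^-1 = q^-1.

  All computations take place on representatives in the free algebra: \<open>rel_class\<close> turns
  the ring operations of the quotient into those of the free algebra, and the congruence rules
  \<open>rel_class_cong\<close> allow a relation to be applied inside an expression.\<close>

section \<open>Congruence modulo the relators, and scalars in the free algebra\<close>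

lemma rel_class_add_cong:
  "rel_class R p = rel_class R p' \<Longrightarrow> rel_class R r = rel_class R r'
    \<Longrightarrow> rel_class R (p + r) = rel_class R (p' + r')"
  by (metis presented_alg_simps(5))

lemma rel_class_diff_cong:
  "rel_class R p = rel_class R p' \<Longrightarrow> rel_class R r = rel_class R r'
    \<Longrightarrow> rel_class R (p - r) = rel_class R (p' - r')"
  by (metis presented_alg_minus)

lemma rel_class_mult_cong:
  "rel_class R p = rel_class R p' \<Longrightarrow> rel_class R r = rel_class R r'
    \<Longrightarrow> rel_class R (p * r) = rel_class R (p' * r')"
  by (metis presented_alg_simps(4))

lemmas rel_class_cong = rel_class_add_cong rel_class_diff_cong rel_class_mult_cong

lemma presented_alg_square:
  "rel_class R p [^]\<^bsub>presented_alg R\<^esub> (2::nat) = rel_class R (p * p)"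
proof -
  interpret ring "presented_alg R" by (rule ring_presented_alg)
  show ?thesis by (simp add: numeral_2_eq_2 presented_alg_simps)
qed

lemma scal_left_commute: "p * (scal c * r) = scal c * (p * r)"
  by (metis mult.assoc scal_central)

text \<open>As a rewrite rule, \<open>scal_left_commute\<close> would loop on two nested scalars.
  Restricted to a generator on the left, it moves scalars outwards and terminates.\<close>

lemmas gen_scal_left_commute = scal_left_commute[of "gen g" for g]

lemma scal_scal: "scal c * (scal d * p) = scal (c * d) * p"
  by (simp add: scal_simps(2) mult.assoc)

lemma scal_scal_eq: "c * d = b \<Longrightarrow> scal c * (scal d * p) = scal b * p"
  by (simp add: scal_scal)

lemma scal_diff: "scal (c - d) = scal c - scal d"
  by (simp add: scal_def single_diff)

section \<open>Commutation rules for e, f and k\<close>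

text \<open>The defining relations, oriented for normal ordering: k moves to the right of e and f,
  and e moves to the left of f.\<close>

lemma Uq_rel_class:
  fixes q :: "'f::field"
  defines "R \<equiv> Uq_relators q"
  shows "rel_class R (gen K * gen K_inv) = rel_class R 1"
    and "rel_class R (gen K_inv * gen K) = rel_class R 1"
    and "rel_class R (gen K * gen E) = rel_class R (scal (q^2) * (gen E * gen K))"
    and "rel_class R (gen K * gen F) = rel_class R (scal (inverse (q^2)) * (gen F * gen K))"
    and "rel_class R (gen F * gen E) = rel_class R
      (gen E * gen F - scal (inverse (q - inverse q)) * (gen K - gen K_inv))"
proof -
  show k: "rel_class R (gen K * gen K_inv) = rel_class R 1"
    "rel_class R (gen K_inv * gen K) = rel_class R 1"
    by (rule rel_class_relator; simp add: R_def Uq_relators_def)+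
  \<comment> \<open>A conjugation relation becomes a commutation relation by inserting k^-1 k on the
    right.\<close>
  have *: "rel_class R (gen K * p) = rel_class R (scal c * (p * gen K))"
    if "rel_class R (gen K * p * gen K_inv) = rel_class R (scal c * p)" for p c
  proof -
    have "rel_class R (gen K * p) = rel_class R (gen K * p * 1)" by simp
    also have "\<dots> = rel_class R (gen K * p * (gen K_inv * gen K))"
      by (intro rel_class_cong refl k(2)[symmetric])
    also have "\<dots> = rel_class R ((gen K * p * gen K_inv) * gen K)"
      by (simp add: mult.assoc)
    also have "\<dots> = rel_class R (scal c * p * gen K)"
      by (intro rel_class_cong refl that)
    finally show ?thesis by (simp add: mult.assoc)
  qed
  show "rel_class R (gen K * gen E) = rel_class R (scal (q^2) * (gen E * gen K))"
    by (intro * rel_class_relator) (simp add: R_def Uq_relators_def)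
  show "rel_class R (gen K * gen F) = rel_class R (scal (inverse (q^2)) * (gen F * gen K))"
    by (intro * rel_class_relator) (simp add: R_def Uq_relators_def)
  have "rel_class R (gen E * gen F - gen F * gen E)
      = rel_class R (scal (inverse (q - inverse q)) * (gen K - gen K_inv))"
    by (intro rel_class_relator) (simp add: R_def Uq_relators_def)
  from rel_class_diff_cong[OF refl this, of "gen E * gen F"]
  show "rel_class R (gen F * gen E) = rel_class R
      (gen E * gen F - scal (inverse (q - inverse q)) * (gen K - gen K_inv))"
    by simp
qed

lemma Uq_conjugate:
  fixes q :: "'f::field"
  assumes "q \<noteq> 0"
  defines "R \<equiv> Uq_relators q"
  shows "rel_class R (gen K_inv * (gen E * gen K)) = rel_class R (scal (inverse (q^2)) * gen E)"
    and "rel_class R (gen K_inv * (gen F * gen K)) = rel_class R (scal (q^2) * gen F)"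
proof -
  note rels = Uq_rel_class[of q, folded R_def]
  \<comment> \<open>Here k^-1 k is inserted to the left of \<open>p\<close>, and k is then moved
    past \<open>p\<close>.\<close>
  have *: "rel_class R (gen K_inv * (p * gen K)) = rel_class R (scal d * p)"
    if "rel_class R (gen K * p) = rel_class R (scal c * (p * gen K))" and "d * c = 1" for p c d
  proof -
    have "rel_class R (scal d * p) = rel_class R (scal d * (1 * p))" by simp
    also have "\<dots> = rel_class R (scal d * ((gen K_inv * gen K) * p))"
      by (intro rel_class_cong refl rels(2)[symmetric])
    also have "\<dots> = rel_class R (scal d * (gen K_inv * (gen K * p)))"
      by (simp add: mult.assoc)
    also have "\<dots> = rel_class R (scal d * (gen K_inv * (scal c * (p * gen K))))"
      by (intro rel_class_cong refl that(1))
    also have "\<dots> = rel_class R (scal (d * c) * (gen K_inv * (p * gen K)))"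
      by (simp add: gen_scal_left_commute scal_simps mult.assoc)
    finally show ?thesis using that(2) by (simp add: scal_simps)
  qed
  show "rel_class R (gen K_inv * (gen E * gen K)) = rel_class R (scal (inverse (q^2)) * gen E)"
    by (rule *[OF rels(3)]) (use assms(1) in simp)
  show "rel_class R (gen K_inv * (gen F * gen K)) = rel_class R (scal (q^2) * gen F)"
    by (rule *[OF rels(4)]) (use assms(1) in simp)
qed

text \<open>The factors q^-2 from e and q^2 from f cancel: ef has weight zero and so commutes with
  k.\<close>

lemma Uq_conjugate_E_F:
  fixes q :: "'f::field"
  assumes "q \<noteq> 0"
  defines "R \<equiv> Uq_relators q"
  shows "rel_class R (gen K_inv * (gen E * (gen F * gen K))) = rel_class R (gen E * gen F)"
proof -
  note rels = Uq_rel_class[of q, folded R_def]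
    and conj = Uq_conjugate[OF assms(1), folded R_def]
  have F: "rel_class R (gen F * gen K) = rel_class R (scal (q^2) * (gen K * gen F))"
  proof -
    have "rel_class R (scal (q^2) * (gen K * gen F))
        = rel_class R (scal (q^2) * (scal (inverse (q^2)) * (gen F * gen K)))"
      by (intro rel_class_cong refl rels(4))
    also have "scal (q^2) * (scal (inverse (q^2)) * (gen F * gen K)) = gen F * gen K"
      using assms(1) by (simp add: scal_scal scal_simps(3))
    finally show ?thesis by simp
  qed
  have "rel_class R (gen K_inv * (gen E * (gen F * gen K)))
      = rel_class R (gen K_inv * (gen E * (scal (q^2) * (gen K * gen F))))"
    by (intro rel_class_cong refl F)
  also have "\<dots> = rel_class R (scal (q^2) * ((gen K_inv * (gen E * gen K)) * gen F))"
    by (simp add: gen_scal_left_commute mult.assoc)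
  also have "\<dots> = rel_class R (scal (q^2) * ((scal (inverse (q^2)) * gen E) * gen F))"
    by (intro rel_class_cong refl conj(1))
  also have "scal (q^2) * ((scal (inverse (q^2)) * gen E) * gen F) = gen E * gen F"
    using assms(1) by (simp add: scal_scal scal_simps(3) mult.assoc)
  finally show ?thesis .
qed

lemma scal_zero: "scal 0 = 0"
  by (simp add: scal_def)

lemma scal_minus: "scal (- c) = - scal c"
  by (simp add: scal_def single_uminus)

text \<open>Eliminates \<open>u\<close> between two combinations of 1, \<open>u\<close>,
  \<open>v\<close> with equal constant term, when their coefficients of \<open>u\<close> have ratio
  \<open>r\<close>. It is applied to Ay and yA with \<open>u\<close> the generator e and
  \<open>v\<close> the product fk, once with \<open>r\<close> = q^-2 and once with \<open>r\<close>
  = q^2.\<close>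

lemma scal_eliminate:
  "scal s - scal (r * b) * u + scal c * v - scal r * (scal s - scal b * u + scal d * v)
    = scal (s * (1 - r)) + scal (c - r * d) * v"
  by (simp add: scal_diff scal_scal algebra_simps flip: scal_simps(2))

section \<open>The element A and its products with y\<close>

text \<open>A representative of A in the free algebra, obtained by substituting x and z and
  collecting the two k^-1 terms.\<close>

definition A_lift :: "'f::field \<Rightarrow> 'f \<Rightarrow> (chevalley, 'f) free_alg" where
  "A_lift q a = scal (a + inverse a) * gen K_inv
     - scal (inverse a * q * (q - inverse q)) * (gen K_inv * gen E)
     + scal (a * (q - inverse q)) * gen F"

lemma Uq_A_eq: "Uq_A q a = rel_class (Uq_relators q) (A_lift q a)"
proof -
  have "scal (inverse a) * (gen K_inv - scal (q * (q - inverse q)) * (gen K_inv * gen E))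
      + scal a * (gen K_inv + scal (q - inverse q) * gen F) = A_lift q a"
    unfolding A_lift_def by (simp add: scal_simps(1) scal_scal algebra_simps)
  then show ?thesis
    by (simp add: Uq_A_def Uq_x_def Uq_z_def Uq_def Uq_k_inv_def Uq_e_def Uq_f_def
        presented_alg_simps presented_alg_minus)
qed

text \<open>From Ay to yA the e term gains a factor q^2 and the fk term a factor q^-2, while the
  constant stays the same. These opposite weights are what makes the later elimination of e
  possible.\<close>

lemma A_y_class:
  fixes q a :: "'f::field"
  assumes "q \<noteq> 0"
  defines "R \<equiv> Uq_relators q"
  shows "rel_class R (A_lift q a * gen K) = rel_class R (scal (a + inverse a)
      - scal (inverse a * inverse q * (q - inverse q)) * gen E
      + scal (a * (q - inverse q)) * (gen F * gen K))" (is "?AK = ?B")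
    and "rel_class R (gen K * A_lift q a) = rel_class R (scal (a + inverse a)
      - scal (inverse a * q * (q - inverse q)) * gen E
      + scal (a * (q - inverse q) * inverse (q^2)) * (gen F * gen K))" (is "?KA = ?C")
proof -
  note rels = Uq_rel_class[of q, folded R_def]
    and conj = Uq_conjugate[OF assms(1), folded R_def]
  have "?AK = rel_class R (scal (a + inverse a) * (gen K_inv * gen K)
      - scal (inverse a * q * (q - inverse q)) * (gen K_inv * (gen E * gen K))
      + scal (a * (q - inverse q)) * (gen F * gen K))"
    unfolding A_lift_def by (simp add: algebra_simps)
  also have "\<dots> = rel_class R (scal (a + inverse a) * 1
      - scal (inverse a * q * (q - inverse q)) * (scal (inverse (q^2)) * gen E)
      + scal (a * (q - inverse q)) * (gen F * gen K))"
    by (intro rel_class_cong refl rels conj)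
  also have "scal (inverse a * q * (q - inverse q)) * (scal (inverse (q^2)) * gen E)
      = scal (inverse a * inverse q * (q - inverse q)) * gen E"
    \<comment> \<open>The case a = 0 is permitted here; both sides then vanish because
      \<open>inverse 0 = 0\<close>.\<close>
    by (rule scal_scal_eq, cases "a = 0")
      (use assms(1) in \<open>simp_all add: field_simps power2_eq_square\<close>)
  finally show "?AK = ?B" by simp
  have "?KA = rel_class R (scal (a + inverse a) * (gen K * gen K_inv)
      - scal (inverse a * q * (q - inverse q)) * ((gen K * gen K_inv) * gen E)
      + scal (a * (q - inverse q)) * (gen K * gen F))"
    unfolding A_lift_def by (simp add: distrib_left right_diff_distrib gen_scal_left_commute mult.assoc)
  also have "\<dots> = rel_class R (scal (a + inverse a) * 1
      - scal (inverse a * q * (q - inverse q)) * (1 * gen E)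
      + scal (a * (q - inverse q)) * (scal (inverse (q^2)) * (gen F * gen K)))"
    by (intro rel_class_cong refl rels)
  also have "\<dots> = ?C"
    by (simp flip: mult.assoc scal_simps(2))
  finally show "?KA = ?C" .
qed

section \<open>The twisted commutator and the cubic expression in A and y\<close>

text \<open>The twist q^-2 undoes the factor q^2 from conjugating f by k^-1, so the f terms cancel,
  and it also matches the two ffk terms. Only ef and fe survive, and reordering fe produces k and
  k^-1.\<close>

lemma twisted_commutator_class:
  fixes q a :: "'f::field"
  assumes q: "q \<noteq> 0" and h: "q - inverse q \<noteq> 0" and a: "a \<noteq> 0"
  defines "R \<equiv> Uq_relators q"
  shows "rel_class R (scal (inverse (q^2)) * (A_lift q a * (gen F * gen K)) - gen F * (gen K * A_lift q a))
    = rel_class R (scal (inverse a) * (scal ((q - inverse q)^2) * (gen E * gen F)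
        - scal q * gen K + scal q * gen K_inv))"
proof -
  note rels = Uq_rel_class[of q, folded R_def]
    and conj = Uq_conjugate[OF assms(1), folded R_def] Uq_conjugate_E_F[OF assms(1), folded R_def]
    and Ay = A_y_class[OF assms(1), of a, folded R_def]
  let ?h = "q - inverse q"
  have "rel_class R (scal (inverse (q^2)) * (A_lift q a * (gen F * gen K)) - gen F * (gen K * A_lift q a))
    = rel_class R (scal (inverse (q^2)) * (scal (a + inverse a) * (gen K_inv * (gen F * gen K))
      - scal (inverse a * q * ?h) * (gen K_inv * (gen E * (gen F * gen K)))
      + scal (a * ?h) * (gen F * (gen F * gen K))) - gen F * (gen K * A_lift q a))"
    unfolding A_lift_def by (simp only: distrib_right left_diff_distrib mult.assoc)
  also have "\<dots> = rel_class R (scal (inverse (q^2)) * (scal (a + inverse a) * (scal (q^2) * gen F)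
      - scal (inverse a * q * ?h) * (gen E * gen F)
      + scal (a * ?h) * (gen F * (gen F * gen K)))
      - gen F * (scal (a + inverse a) - scal (inverse a * q * ?h) * gen E
      + scal (a * ?h * inverse (q^2)) * (gen F * gen K)))"
    by (intro rel_class_cong refl conj Ay)
  also have "\<dots> = rel_class R (scal (inverse a * q * ?h) * (gen F * gen E)
      - scal (inverse (q^2) * (inverse a * q * ?h)) * (gen E * gen F))"
  proof -
    have "scal (inverse (q^2)) * (scal (a + inverse a) * (scal (q^2) * gen F))
        = scal (a + inverse a) * gen F"
      unfolding scal_scal using q by (simp add: mult.commute[of _ "q^2"] flip: mult.assoc)
    moreover have "scal (inverse (q^2)) * (scal (a * ?h) * (gen F * (gen F * gen K)))
        = scal (a * ?h * inverse (q^2)) * (gen F * (gen F * gen K))"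
      unfolding scal_scal by (simp only: mult.commute)
    moreover have "gen F * scal (a + inverse a) = scal (a + inverse a) * gen F"
      by (rule scal_central[symmetric])
    ultimately show ?thesis
      by (simp only: distrib_left right_diff_distrib gen_scal_left_commute)
        (simp add: scal_simps(1) scal_scal algebra_simps)
  qed
  also have "\<dots> = rel_class R (scal (inverse a * q * ?h)
        * (gen E * gen F - scal (inverse ?h) * (gen K - gen K_inv))
      - scal (inverse (q^2) * (inverse a * q * ?h)) * (gen E * gen F))"
    by (intro rel_class_cong refl rels)
  also have "scal (inverse a * q * ?h)
        * (gen E * gen F - scal (inverse ?h) * (gen K - gen K_inv))
      - scal (inverse (q^2) * (inverse a * q * ?h)) * (gen E * gen F)
    = scal (inverse a * q * ?h - inverse (q^2) * (inverse a * q * ?h)) * (gen E * gen F)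
      - scal (inverse a * q * ?h * inverse ?h) * gen K
      + scal (inverse a * q * ?h * inverse ?h) * gen K_inv"
    by (simp only: scal_diff scal_simps(2) mult.assoc distrib_left right_diff_distrib left_diff_distrib)
      (simp add: algebra_simps)
  also have "inverse a * q * ?h * inverse ?h = inverse a * q"
    using h by simp
  \<comment> \<open>One factor h comes from A, the other from q - q^-2 q = h.\<close>
  also have "inverse a * q * ?h - inverse (q^2) * (inverse a * q * ?h) = inverse a * ?h^2"
    using q a by (simp add: field_simps power2_eq_square)
  finally show ?thesis
    by (simp add: scal_simps mult.assoc distrib_left right_diff_distrib)
qed

text \<open>
  The coefficient $q^2 + q^{-2}$ is split between the two readings $A(yA)$ and $(Ay)A$, because
  $Ay - q^{-2}yA$ and $yA - q^2Ay$ do not involve $e$ and their constant terms cancel against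
  the last summand.
\<close>

lemma Askey_Wilson_class:
  fixes q a :: "'f::field"
  assumes q: "q \<noteq> 0"
  defines "R \<equiv> Uq_relators q"
  shows "rel_class R (A_lift q a * A_lift q a * gen K
      - scal (q^2 + inverse (q^2)) * (A_lift q a * gen K * A_lift q a)
      + gen K * (A_lift q a * A_lift q a)
      + scal ((a + inverse a) * (q - inverse q)^2) * A_lift q a)
    = rel_class R (scal (a * (q - inverse q) * (q^2 - inverse (q^2)))
        * (scal (inverse (q^2)) * (A_lift q a * (gen F * gen K)) - gen F * (gen K * A_lift q a)))"
proof -
  note Ay = A_y_class[OF assms(1), of a, folded R_def]
  let ?h = "q - inverse q" and ?s = "a + inverse a" and ?p = "inverse (q^2)"
  define A where "A = A_lift q a"
  define B where "B = scal ?s - scal (inverse a * inverse q * ?h) * gen E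
      + scal (a * ?h) * (gen F * gen K)"
  define C where "C = scal ?s - scal (inverse a * q * ?h) * gen E
      + scal (a * ?h * ?p) * (gen F * gen K)"
  have "A * A * gen K - scal (q^2 + ?p) * (A * gen K * A) + gen K * (A * A) + scal (?s * ?h^2) * A
    = A * (A * gen K) - scal ?p * (A * (gen K * A)) - scal (q^2) * ((A * gen K) * A)
      + (gen K * A) * A + scal (?s * ?h^2) * A"
    by (simp add: scal_simps(1) algebra_simps)
  also have "rel_class R \<dots> = rel_class R (A * B - scal ?p * (A * C) - scal (q^2) * (B * A)
      + C * A + scal (?s * ?h^2) * A)"
    unfolding A_def B_def C_def by (intro rel_class_cong refl Ay)
  \<comment> \<open>\<open>B\<close> and \<open>C\<close> stand for Ay and yA; the terms are grouped
    so that e drops out of each bracket.\<close>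
  also have "A * B - scal ?p * (A * C) - scal (q^2) * (B * A) + C * A + scal (?s * ?h^2) * A
    = A * (B - scal ?p * C) + (C - scal (q^2) * B) * A + scal (?s * ?h^2) * A"
    by (simp add: distrib_left distrib_right left_diff_distrib right_diff_distrib
        scal_left_commute[of A] mult.assoc)
  also have "B - scal ?p * C
      = scal (?s * (1 - ?p)) + scal (a * ?h * (1 - ?p * ?p)) * (gen F * gen K)"
  proof -
    have "inverse a * inverse q * ?h = ?p * (inverse a * q * ?h)"
      using q by (cases "a = 0") (simp_all add: field_simps power2_eq_square)
    then show ?thesis
      unfolding B_def C_def by (simp only: scal_eliminate) (simp add: algebra_simps)
  qed
  also have "C - scal (q^2) * B
      = scal (?s * (1 - q^2)) + scal (a * ?h * (?p - q^2)) * (gen F * gen K)"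
  proof -
    have "inverse a * q * ?h = q^2 * (inverse a * inverse q * ?h)"
      using q by (cases "a = 0") (simp_all add: field_simps power2_eq_square)
    then show ?thesis
      unfolding B_def C_def by (simp only: scal_eliminate) (simp add: algebra_simps)
  qed
  also have "A * (scal (?s * (1 - ?p)) + scal (a * ?h * (1 - ?p * ?p)) * (gen F * gen K))
      + (scal (?s * (1 - q^2)) + scal (a * ?h * (?p - q^2)) * (gen F * gen K)) * A
      + scal (?s * ?h^2) * A
    = scal (?s * (1 - ?p) + ?s * (1 - q^2) + ?s * ?h^2) * A
      + scal (a * ?h * (1 - ?p * ?p)) * (A * (gen F * gen K))
      + scal (a * ?h * (?p - q^2)) * (gen F * (gen K * A))"
    by (simp add: scal_simps(1) distrib_left distrib_right scal_left_commute[of A] mult.assoc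
        scal_central[of _ A, symmetric])
  \<comment> \<open>The coefficient s h^2 is exactly what cancels, since (1 - q^-2) + (1 - q^2) =
    -h^2.\<close>
  also have "?s * (1 - ?p) + ?s * (1 - q^2) + ?s * ?h^2 = 0"
  proof -
    have "?h^2 = q^2 + ?p - 2"
      using q by (simp add: power2_diff power_inverse)
    then show ?thesis by (simp only:) (simp add: algebra_simps)
  qed
  also have "a * ?h * (1 - ?p * ?p) = a * ?h * (q^2 - ?p) * ?p"
    using q by (simp add: field_simps power2_eq_square)
  also have "a * ?h * (?p - q^2) = - (a * ?h * (q^2 - ?p))"
    by (simp add: algebra_simps)
  also have "scal 0 * A + scal (a * ?h * (q^2 - ?p) * ?p) * (A * (gen F * gen K))
      + scal (- (a * ?h * (q^2 - ?p))) * (gen F * (gen K * A))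
    = scal (a * ?h * (q^2 - ?p)) * (scal ?p * (A * (gen F * gen K)) - gen F * (gen K * A))"
    unfolding scal_zero scal_minus right_diff_distrib[of "scal _"] scal_scal by simp
  finally show ?thesis unfolding A_def .
qed

section \<open>Recovering the Casimir element\<close>

theorem lemma7p15:
  fixes q a :: "'f::field"
  assumes "q \<noteq> 0" and "q^4 \<noteq> 1" and "a \<noteq> 0" and "a^2 \<noteq> 1"
  shows "let U = Uq q; A = Uq_A q a; y = Uq_y q in
    Uq_Casimir q =
      inverse ((q - inverse q) * (q^2 - inverse (q^2))) \<odot>\<^bsub>U\<^esub>
        ((A [^]\<^bsub>U\<^esub> (2::nat)) \<otimes>\<^bsub>U\<^esub> y
         \<ominus>\<^bsub>U\<^esub> (q^2 + inverse (q^2)) \<odot>\<^bsub>U\<^esub> (A \<otimes>\<^bsub>U\<^esub> y \<otimes>\<^bsub>U\<^esub> A)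
         \<oplus>\<^bsub>U\<^esub> y \<otimes>\<^bsub>U\<^esub> (A [^]\<^bsub>U\<^esub> (2::nat))
         \<oplus>\<^bsub>U\<^esub> ((q^2 - inverse (q^2))^2) \<odot>\<^bsub>U\<^esub> y
         \<oplus>\<^bsub>U\<^esub> ((a + inverse a) * (q - inverse q)^2) \<odot>\<^bsub>U\<^esub> A)"
proof -
  let ?h = "q - inverse q" and ?w = "q^2 - inverse (q^2)"
  define R where "R = Uq_relators q"
  define A where "A = A_lift q a"
  \<comment> \<open>If w were 0, multiplying by q^2 would give q^4 = 1. Since h divides w, h is
    nonzero as well.\<close>
  have w: "?w \<noteq> 0"
    using assms(1,2) by (auto simp: field_simps simp flip: power_add)
  have hw: "?h * (q + inverse q) = ?w"
    using assms(1) by (simp add: field_simps power2_eq_square)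
  then have h: "?h \<noteq> 0" using w by auto
  define P where "P = A * A * gen K - scal (q^2 + inverse (q^2)) * (A * gen K * A)
      + gen K * (A * A) + scal ((a + inverse a) * ?h^2) * A"
  \<comment> \<open>\<open>L\<close> is the Casimir expression with -q in place of q^-1 as the
    coefficient of k.\<close>
  define L where "L = scal (?h^2) * (gen E * gen F) - scal q * gen K + scal q * gen K_inv"
  have "rel_class R P = rel_class R (scal (a * ?h * ?w) * (scal (inverse (q^2)) * (A * (gen F * gen K))
      - gen F * (gen K * A)))"
    unfolding P_def A_def R_def by (rule Askey_Wilson_class[OF assms(1)])
  also have "\<dots> = rel_class R (scal (a * ?h * ?w) * (scal (inverse a) * L))"
    unfolding L_def A_def R_def
    by (intro rel_class_cong refl twisted_commutator_class assms(1,3) h)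
  also have "scal (a * ?h * ?w) * (scal (inverse a) * L) = scal (?h * ?w) * L"
    using assms(3) by (intro scal_scal_eq) simp
  finally have P: "rel_class R P = rel_class R (scal (?h * ?w) * L)" .
  have "rel_class R (scal (inverse (?h * ?w)) * (P + scal (?w^2) * gen K))
    = rel_class R (scal (inverse (?h * ?w)) * (scal (?h * ?w) * L + scal (?w^2) * gen K))"
    by (intro rel_class_cong refl P)
  also have "scal (inverse (?h * ?w)) * (scal (?h * ?w) * L + scal (?w^2) * gen K)
    = scal (inverse (?h * ?w) * (?h * ?w)) * L + scal (inverse (?h * ?w) * ?w^2) * gen K"
    by (simp add: distrib_left scal_simps(2) mult.assoc)
  also have "inverse (?h * ?w) * (?h * ?w) = 1"
    by (rule left_inverse) (use h w in simp)
  \<comment> \<open>The quotient w/h = q + q^-1 is the amount by which the coefficient of k in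
    \<open>L\<close> has to be raised.\<close>
  also have "inverse (?h * ?w) * ?w^2 = q + inverse q"
  proof -
    have "inverse (?h * ?w) * ?w^2 = inverse ?h * ?w"
      using w by (simp add: power2_eq_square)
    also have "\<dots> = q + inverse q" using h by (simp flip: hw)
    finally show ?thesis .
  qed
  also have "scal 1 * L + scal (q + inverse q) * gen K
    = scal (?h^2) * (gen E * gen F) + scal (inverse q) * gen K + scal q * gen K_inv"
    by (simp add: L_def scal_simps(1,3) distrib_right)
  finally have main: "rel_class R (scal (?h^2) * (gen E * gen F) + scal (inverse q) * gen K + scal q * gen K_inv)
    = rel_class R (scal (inverse (?h * ?w)) * (P + scal (?w^2) * gen K))" ..
  have P': "P + scal (?w^2) * gen K = A * A * gen K
      - scal (q^2 + inverse (q^2)) * (A * gen K * A) + gen K * (A * A)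
      + scal (?w^2) * gen K + scal ((a + inverse a) * ?h^2) * A"
    by (simp add: P_def algebra_simps)
  show ?thesis
    using main unfolding P' A_def R_def
    by (simp only: Let_def Uq_A_eq Uq_Casimir_def Uq_y_def Uq_def Uq_k_def Uq_k_inv_def Uq_e_def
        Uq_f_def presented_alg_square presented_alg_simps presented_alg_minus)
qed

end
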